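(* Let $P\subseteq\{0,1\}^k$ be a relation which embeds into a relation $A\subseteq D^k$, where $D$ is a (possibly infinite) set, such that $A$ has a Mal'tsev polymorphism $\varphi:D^3\to D$. Then $P$ is balanced.
   Context: $P$ embeds into $A$ if there is an injective $\sigma:\{0,1\}\to D$ with $\sigma(P)=A\cap\sigma(\{0,1\})^k$. A Mal'tsev polymorphism is $\varphi$ with $\varphi(a,a,b)=\varphi(b,a,a)=b$ for all $a,b\in D$ such that $\varphi$ applied componentwise to any three tuples of $A$ yields a tuple of $A$. $P$ is balanced if for every odd $m$ and all $t^1,\dots,t^m\in P$ such that $t^1_i-t^2_i+t^3_i-\dots+t^m_i\in\{0,1\}$ (computed in $\mathbb Z$) for every $i\in[k]$, the tuple $t^1-t^2+t^3-\dots+t^m$ belongs to $P$. *)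

theory Defs
  imports Complex_Main "HOL-Library.FuncSet"
begin

text \<open>A \<open>k\<close>-tuple over a set \<open>D\<close> is an extensional function on \<open>{1..k}\<close>, and Boolean values
  are the integers \<open>0\<close> and \<open>1\<close>, so that alternating sums are computed in the integers.\<close>

definition tuples :: "nat \<Rightarrow> 'a set \<Rightarrow> (nat \<Rightarrow> 'a) set" where
  "tuples k D = {1..k} \<rightarrow>\<^sub>E D"

definition embeds_into ::
    "nat \<Rightarrow> (nat \<Rightarrow> int) set \<Rightarrow> 'a set \<Rightarrow> (nat \<Rightarrow> 'a) set \<Rightarrow> bool" where
  "embeds_into k P D A \<longleftrightarrow>
     (\<exists>\<sigma>. \<sigma> \<in> {0, 1} \<rightarrow> D \<and> inj_on \<sigma> {0, 1} \<and>
          (\<lambda>t. \<lambda>i\<in>{1..k}. \<sigma> (t i)) ` P = A \<inter> tuples k (\<sigma> ` {0, 1}))"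

definition maltsev_polymorphism ::
    "nat \<Rightarrow> 'a set \<Rightarrow> (nat \<Rightarrow> 'a) set \<Rightarrow> ('a \<Rightarrow> 'a \<Rightarrow> 'a \<Rightarrow> 'a) \<Rightarrow> bool" where
  "maltsev_polymorphism k D A \<phi> \<longleftrightarrow>
     (\<forall>a\<in>D. \<forall>b\<in>D. \<forall>c\<in>D. \<phi> a b c \<in> D) \<and>
     (\<forall>a\<in>D. \<forall>b\<in>D. \<phi> a a b = b \<and> \<phi> b a a = b) \<and>
     (\<forall>x\<in>A. \<forall>y\<in>A. \<forall>z\<in>A. (\<lambda>i\<in>{1..k}. \<phi> (x i) (y i) (z i)) \<in> A)"

definition alternating_sum ::
    "nat \<Rightarrow> nat \<Rightarrow> (nat \<Rightarrow> nat \<Rightarrow> int) \<Rightarrow> nat \<Rightarrow> int" where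
  "alternating_sum k m t = (\<lambda>i\<in>{1..k}. \<Sum>j=1..m. (- 1) ^ (j + 1) * t j i)"

definition balanced :: "nat \<Rightarrow> (nat \<Rightarrow> int) set \<Rightarrow> bool" where
  "balanced k P \<longleftrightarrow>
     (\<forall>m t. odd m \<and> (\<forall>j\<in>{1..m}. t j \<in> P) \<and>
            (\<forall>i\<in>{1..k}. alternating_sum k m t i \<in> {0, 1})
        \<longrightarrow> alternating_sum k m t \<in> P)"

end

theory Submission
  imports Defs
begin

text \<open>
  The idea is to find, for every odd \<open>m\<close>, an \<open>m\<close>-ary term \<open>f\<close> over \<open>\<phi>\<close> whose value on a word
  \<open>x \<in> {0,1}\<^sup>m\<close> (read through \<open>\<sigma>\<close>) depends only on the alternating sum of \<open>x\<close>. As terms are idempotent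
  and the constant words \<open>0\<close> and \<open>1\<close> have alternating sums \<open>0\<close> and \<open>1\<close>, such an \<open>f\<close> computes the
  alternating sum whenever that is \<open>0\<close> or \<open>1\<close>, and terms preserve \<open>A\<close>.

  To pass from \<open>m\<close> to \<open>m + 2\<close>, note that the \<open>m\<close>-ary \<open>f\<close> already gives the right value on those words
  in which the letter \<open>m\<close> or \<open>m + 1\<close> cancels against a letter \<open>r < m\<close> of opposite sign, once \<open>r\<close> is
  overwritten by the other new letter. Which \<open>r\<close> works depends on the word, but the terms for the
  different \<open>r\<close> can be merged, since \<open>\<phi> p q h\<close> is right wherever \<open>h\<close> is right and \<open>p = q\<close>,
  or \<open>p\<close> is right and \<open>q = h\<close>. The two words without any cancellation are the strictly alternating
  ones, and these are determined by their extremal alternating sums.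
\<close>

section \<open>Term operations over a ternary operation\<close>

inductive_set terms :: "('a \<Rightarrow> 'a \<Rightarrow> 'a \<Rightarrow> 'a) \<Rightarrow> nat \<Rightarrow> ((nat \<Rightarrow> 'a) \<Rightarrow> 'a) set"
  for \<phi> n where
  proj: "j < n \<Longrightarrow> (\<lambda>x. x j) \<in> terms \<phi> n"
| app: "\<lbrakk>f \<in> terms \<phi> n; g \<in> terms \<phi> n; h \<in> terms \<phi> n\<rbrakk> \<Longrightarrow>
    (\<lambda>x. \<phi> (f x) (g x) (h x)) \<in> terms \<phi> n"

lemma terms_rename:
  assumes "f \<in> terms \<phi> m" and "\<And>j. j < m \<Longrightarrow> r j < n"
  shows "(\<lambda>x. f (\<lambda>j. x (r j))) \<in> terms \<phi> n"
  using assms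
proof (induction rule: terms.induct)
  case (proj j)
  then show ?case by (intro terms.proj)
next
  case (app f g h)
  show ?case by (intro terms.app app.IH app.prems)
qed

lemma terms_update:
  assumes "f \<in> terms \<phi> m" "m \<le> n" "k < n"
  shows "(\<lambda>x. f (x(i := x k))) \<in> terms \<phi> n"
proof -
  have "x(i := x k) = (\<lambda>j. x (if j = i then k else j))" for x :: "nat \<Rightarrow> 'a"
    by auto
  then show ?thesis
    using terms_rename[OF assms(1), of "\<lambda>j. if j = i then k else j" n] assms(2,3) by simp
qed

lemma terms_mono: "f \<in> terms \<phi> m \<Longrightarrow> m \<le> n \<Longrightarrow> f \<in> terms \<phi> n"
  using terms_rename[of f \<phi> m "\<lambda>j. j" n] by simp

text \<open>Words are infinite sequences whatever the arity, but only projections below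
  \<open>n\<close> read them.\<close>

lemma terms_cong:
  assumes "f \<in> terms \<phi> n" and "\<And>j. j < n \<Longrightarrow> x j = y j"
  shows "f x = f y"
  using assms by (induction rule: terms.induct) auto

lemma terms_closed:
  assumes "f \<in> terms \<phi> n" and "\<forall>a\<in>D. \<forall>b\<in>D. \<forall>c\<in>D. \<phi> a b c \<in> D" and "\<And>j. x j \<in> D"
  shows "f x \<in> D"
  using assms by (induction rule: terms.induct) auto

lemma terms_idem:
  assumes "f \<in> terms \<phi> n" and "\<phi> a a a = a"
  shows "f (\<lambda>_. a) = a"
  using assms by (induction rule: terms.induct) auto

lemma terms_preserve:
  assumes "f \<in> terms \<phi> n" and "A \<subseteq> tuples k D" and "maltsev_polymorphism k D A \<phi>"
    and "\<And>j. t j \<in> A"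
  shows "(\<lambda>i\<in>{1..k}. f (\<lambda>j. t j i)) \<in> A"
  using assms(1)
proof (induction rule: terms.induct)
  case (proj j)
  have "t j \<in> {1..k} \<rightarrow>\<^sub>E D"
    using assms(2,4) unfolding tuples_def by blast
  then have "(\<lambda>i\<in>{1..k}. t j i) = t j"
    by (metis PiE_restrict)
  then show ?case
    using assms(4) by simp
next
  case (app f g h)
  have "(\<lambda>i\<in>{1..k}. \<phi> ((\<lambda>i\<in>{1..k}. f (\<lambda>j. t j i)) i) ((\<lambda>i\<in>{1..k}. g (\<lambda>j. t j i)) i)
      ((\<lambda>i\<in>{1..k}. h (\<lambda>j. t j i)) i)) \<in> A"
    using app.IH assms(3) unfolding maltsev_polymorphism_def by blast
  then show ?case
    by (simp add: restrict_def cong: if_cong)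
qed

section \<open>Alternating sums of words\<close>

definition alt :: "nat \<Rightarrow> (nat \<Rightarrow> int) \<Rightarrow> int" where
  "alt m x = (\<Sum>i<m. (- 1) ^ i * x i)"

lemma alt_0 [simp]: "alt 0 x = 0"
  by (simp add: alt_def)

lemma alt_Suc [simp]: "alt (Suc m) x = alt m x + (- 1) ^ m * x m"
  by (simp add: alt_def)

lemma alt_cong: "(\<And>i. i < m \<Longrightarrow> x i = y i) \<Longrightarrow> alt m x = alt m y"
  by (simp add: alt_def)

lemma alt_update: "r < m \<Longrightarrow> alt m (x(r := v)) = alt m x + (- 1) ^ r * (v - x r)"
proof (induction m)
  case (Suc m)
  show ?case
  proof (cases "r = m")
    case True
    have "alt m (x(m := v)) = alt m x"
      by (rule alt_cong) auto
    with True show ?thesis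
      by (simp add: algebra_simps del: fun_upd_apply) (simp add: algebra_simps)
  qed (use Suc in auto)
qed simp

abbreviation bits :: "(nat \<Rightarrow> int) set" where
  "bits \<equiv> UNIV \<rightarrow> {0, 1}"

text \<open>Of the letters, \<open>n + 1\<close> count positively and \<open>n\<close>
  negatively.\<close>

lemma alt_bounds:
  assumes "x \<in> bits"
  shows "alt (2 * n + 1) x \<in> {- int n..int n + 1}"
proof (induction n)
  case 0
  have "x 0 \<in> {0, 1}" using assms by blast
  then show ?case by auto
next
  case (Suc n)
  have "x (2 * n + 1) \<in> {0, 1}" "x (2 * n + 2) \<in> {0, 1}"
    using assms by blast+
  with Suc show ?case by auto
qed

lemma alt_const: "alt (2 * n + 1) (\<lambda>_. v) = v"
  by (induction n) auto

text \<open>When \<open>u\<close> and \<open>v\<close> are the two bits in either order, these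
  values attain the bounds of \<open>alt_bounds\<close>.\<close>

lemma alt_alternating: "alt (2 * n + 1) (\<lambda>i. if even i then u else v) = (int n + 1) * u - int n * v"
  by (induction n) (auto simp: algebra_simps)

text \<open>As \<open>m\<close> is odd, the new letter \<open>p\<close> has the sign opposite to
  that of \<open>r\<close>, and \<open>q\<close> has the same sign as \<open>r\<close>. Once
  \<open>r\<close> is overwritten by \<open>x p\<close>, these two cancel, and the remaining letter
  \<open>q\<close> can move into slot \<open>r\<close>.\<close>

lemma alt_cancel:
  fixes m r :: nat
  assumes "odd m" "r < m"
  defines "p \<equiv> if even r then m else m + 1" and "q \<equiv> if even r then m + 1 else m"
  shows "alt (m + 2) (x(r := x p)) = alt m (x(r := x q))"
  using assms by (auto simp: alt_update)

section \<open>Passing from arity \<open>m\<close> to \<open>m + 2\<close>\<close>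

lemma alternating_term_step:
  fixes \<sigma> :: "int \<Rightarrow> 'a"
  assumes closed: "\<forall>a\<in>D. \<forall>b\<in>D. \<forall>c\<in>D. \<phi> a b c \<in> D"
    and maltsev: "\<forall>a\<in>D. \<forall>b\<in>D. \<phi> a a b = b \<and> \<phi> b a a = b"
    and \<sigma>: "\<sigma> \<in> {0, 1} \<rightarrow> D"
    and m: "odd m"
    and f: "f \<in> terms \<phi> m"
    and f_alt: "\<And>x y. x \<in> bits \<Longrightarrow> y \<in> bits \<Longrightarrow> alt m x = alt m y \<Longrightarrow> f (\<sigma> \<circ> x) = f (\<sigma> \<circ> y)"
  shows "\<exists>g\<in>terms \<phi> (m + 2). \<forall>x\<in>bits. \<forall>y\<in>bits.
           alt (m + 2) x = alt (m + 2) y \<longrightarrow> g (\<sigma> \<circ> x) = g (\<sigma> \<circ> y)"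
proof -
  define opp where "opp r = (if even r then m else m + 1)" for r :: nat
  define same where "same r = (if even r then m + 1 else m)" for r :: nat
  \<comment> \<open>\<open>C m\<close> collects the words with a cancellation that involves a new
    letter; the bound \<open>i < r\<close> lets an induction treat the old letters one at a
    time.\<close>
  define C where "C r = {x \<in> bits. x m = x (m + 1) \<or> (\<exists>i<r. x i = x (opp i))}" for r
  have upd: "x(i := x j) \<in> bits" if "x \<in> bits" for x :: "nat \<Rightarrow> int" and i j
    using that by (simp add: Pi_iff)
  have in_D: "g (\<sigma> \<circ> x) \<in> D" if "g \<in> terms \<phi> n" "x \<in> bits" for g n x
    using that(2) \<sigma> by (intro terms_closed[OF that(1) closed]) (simp add: Pi_iff, metis)
  have \<sigma>_upd: "(\<sigma> \<circ> x)(i := (\<sigma> \<circ> x) j) = \<sigma> \<circ> x(i := x j)" for x i j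
    by auto
  have cancel: "alt (m + 2) (x(r := x (opp r))) = alt m (x(r := x (same r)))" if "r < m" for x r
    using alt_cancel[OF m that, of x] by (simp add: opp_def same_def)
  \<comment> \<open>The value of \<open>f\<close> at any shorter word \<open>u\<close> with the same
    sum is the right one, so \<open>p\<close> is to be right on all of \<open>C r\<close>.\<close>
  have merged: "\<exists>p\<in>terms \<phi> (m + 2). \<forall>x\<in>C r. \<forall>u\<in>bits.
      alt m u = alt (m + 2) x \<longrightarrow> p (\<sigma> \<circ> x) = f (\<sigma> \<circ> u)" if "r \<le> m" for r
    using that
  proof (induction r)
    case 0
    \<comment> \<open>The two new letters have opposite signs, so they cancel when equal and
      \<open>f\<close> itself is right.\<close>
    have "f (\<sigma> \<circ> x) = f (\<sigma> \<circ> u)" if "x \<in> C 0" "u \<in> bits" "alt m u = alt (m + 2) x" for x u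
      using that m by (intro f_alt) (auto simp: C_def)
    moreover have "f \<in> terms \<phi> (m + 2)"
      using f by (rule terms_mono) simp
    ultimately show ?case by blast
  next
    case (Suc r)
    then obtain p where p: "p \<in> terms \<phi> (m + 2)"
      and p_right: "\<And>x u. x \<in> C r \<Longrightarrow> u \<in> bits \<Longrightarrow> alt m u = alt (m + 2) x \<Longrightarrow>
            p (\<sigma> \<circ> x) = f (\<sigma> \<circ> u)"
      by (metis Suc_leD)
    have r: "r < m" using Suc.prems by simp
    \<comment> \<open>On \<open>C (Suc r)\<close>: if the letters \<open>r\<close> and
      \<open>opp r\<close> agree, the first two arguments coincide and the third is right; otherwise
      the first is right and the last two coincide.\<close>
    define g where "g y = \<phi> (p y) (p (y(r := y (opp r)))) (f (y(r := y (same r))))" for y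
    have "(\<lambda>y. p (y(r := y (opp r)))) \<in> terms \<phi> (m + 2)"
      by (rule terms_update[OF p]) (auto simp: opp_def)
    moreover have "(\<lambda>y. f (y(r := y (same r)))) \<in> terms \<phi> (m + 2)"
      by (rule terms_update[OF f]) (auto simp: same_def)
    ultimately have "g \<in> terms \<phi> (m + 2)"
      unfolding g_def using p by (intro terms.app)
    moreover have "g (\<sigma> \<circ> x) = f (\<sigma> \<circ> u)"
      if x: "x \<in> C (Suc r)" and u: "u \<in> bits" and eq: "alt m u = alt (m + 2) x" for x u
    proof -
      let ?q = "x(r := x (opp r))" and ?h = "x(r := x (same r))"
      have xb: "x \<in> bits" using x by (simp add: C_def)
      have g: "g (\<sigma> \<circ> x) = \<phi> (p (\<sigma> \<circ> x)) (p (\<sigma> \<circ> ?q)) (f (\<sigma> \<circ> ?h))"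
        unfolding g_def \<sigma>_upd ..
      have D: "p (\<sigma> \<circ> x) \<in> D" "f (\<sigma> \<circ> ?h) \<in> D"
        using in_D p f xb upd by blast+
      show ?thesis
      proof (cases "x r = x (opp r)")
        case True
        then have "?q = x" by auto
        moreover have "f (\<sigma> \<circ> ?h) = f (\<sigma> \<circ> u)"
          using cancel[OF r, of x] \<open>?q = x\<close> eq by (intro f_alt upd xb u) simp
        ultimately show ?thesis
          using g maltsev D by auto
      next
        case False
        then have xC: "x \<in> C r"
          using x unfolding C_def by (auto simp: less_Suc_eq)
        \<comment> \<open>Overwriting letter \<open>r\<close> touches neither the new letters nor
          those below \<open>r\<close>, so every cancellation witnessing \<open>x \<in> C r\<close>
          survives.\<close>
        have "?q m = ?q (m + 1)" if "x m = x (m + 1)"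
          using that r by simp
        moreover have "?q i = ?q (opp i)" if "i < r" "x i = x (opp i)" for i
          using that r by (simp add: opp_def)
        ultimately have "?q \<in> C r"
          using xC upd[OF xb, of r "opp r"] unfolding C_def mem_Collect_eq by meson
        then have "p (\<sigma> \<circ> ?q) = f (\<sigma> \<circ> ?h)"
          using cancel[OF r, of x] by (intro p_right upd xb) auto
        then show ?thesis
          using g maltsev D p_right[OF xC u eq] by auto
      qed
    qed
    ultimately show ?case by blast
  qed
  obtain p where p: "p \<in> terms \<phi> (m + 2)"
    and p_right: "\<And>x u. x \<in> C m \<Longrightarrow> u \<in> bits \<Longrightarrow> alt m u = alt (m + 2) x \<Longrightarrow>
          p (\<sigma> \<circ> x) = f (\<sigma> \<circ> u)"
    using merged[of m] by blast
  \<comment> \<open>This supplies the \<open>u\<close> without which \<open>p_right\<close> would be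
    vacuous.\<close>
  have shorten: "\<exists>u\<in>bits. alt m u = alt (m + 2) x" if x: "x \<in> C m" for x
  proof -
    have xb: "x \<in> bits" using x by (simp add: C_def)
    consider "x m = x (m + 1)" | i where "i < m" "x i = x (opp i)"
      using x by (auto simp: C_def)
    then show ?thesis
    proof cases
      case 1
      then show ?thesis using xb m by (intro bexI[of _ x]) auto
    next
      case 2
      then have "x(i := x (opp i)) = x" by auto
      then have "alt m (x(i := x (same i))) = alt (m + 2) x"
        using cancel[OF 2(1), of x] by simp
      then show ?thesis using upd[OF xb] by blast
    qed
  qed
  obtain n where n: "m = 2 * n + 1" using m by (elim oddE)
  \<comment> \<open>Without cancellation each old letter differs from the new letter of opposite
    sign, so \<open>e = x (m + 1)\<close> fills the even positions and \<open>1 - e\<close> the odd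
    ones. Both sums lie just outside the range for words of length \<open>m\<close>.\<close>
  have alternates: "\<exists>e\<in>{0, 1}. (\<forall>i<m + 2. x i = (if even i then e else 1 - e)) \<and>
      alt (m + 2) x = (if e = 1 then int n + 2 else - int n - 1)"
    if x: "x \<in> bits" "x \<notin> C m" for x
  proof -
    have b: "x i \<in> {0, 1}" for i using x(1) by blast
    have ne: "x m \<noteq> x (m + 1)" "\<And>i. i < m \<Longrightarrow> x i \<noteq> x (opp i)"
      using x by (auto simp: C_def)
    define e where "e = x (m + 1)"
    have xm: "x m = 1 - e"
      using ne(1) b[of m] b[of "m + 1"] by (auto simp: e_def)
    have pat: "x i = (if even i then e else 1 - e)" if "i < m + 2" for i
    proof -
      consider "i = m + 1" | "i = m" | "i < m" using \<open>i < m + 2\<close> by linarith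
      then show ?thesis
      proof cases
        case 3
        show ?thesis
          using ne(2)[OF 3] b[of i] b[of "m + 1"] xm e_def by (auto simp: opp_def split: if_splits)
      qed (use m xm e_def in auto)
    qed
    have "alt (m + 2) x = alt (m + 2) (\<lambda>i. if even i then e else 1 - e)"
      using pat by (rule alt_cong)
    also have "\<dots> = (int (n + 1) + 1) * e - int (n + 1) * (1 - e)"
      using alt_alternating[of "n + 1" e "1 - e"] by (simp add: n)
    finally have alt: "alt (m + 2) x = (int (n + 1) + 1) * e - int (n + 1) * (1 - e)" .
    have e: "e \<in> {0, 1}" using b unfolding e_def .
    then have "alt (m + 2) x = (if e = 1 then int n + 2 else - int n - 1)"
      unfolding alt by auto
    with pat e show ?thesis by blast
  qed
  have mixed: "alt (m + 2) x \<noteq> alt (m + 2) y" if x: "x \<in> C m" and y: "y \<in> bits" "y \<notin> C m" for x y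
  proof -
    obtain u where "u \<in> bits" "alt m u = alt (m + 2) x"
      using shorten[OF x] by blast
    then have "alt (m + 2) x \<in> {- int n..int n + 1}"
      using alt_bounds[of u n] by (simp add: n)
    then show ?thesis
      using alternates[OF y] by (auto split: if_splits)
  qed
  \<comment> \<open>Inside \<open>C m\<close> both values equal \<open>f\<close> at a common
    \<open>u\<close>; outside, the sum determines \<open>e\<close> and hence all letters below
    \<open>m + 2\<close>.\<close>
  have "p (\<sigma> \<circ> x) = p (\<sigma> \<circ> y)"
    if x: "x \<in> bits" and y: "y \<in> bits" and eq: "alt (m + 2) x = alt (m + 2) y" for x y
  proof (cases "x \<in> C m")
    case True
    then have "y \<in> C m" using mixed y eq by metis
    then show ?thesis using True shorten p_right eq by metis
  next
    case False
    then have "y \<notin> C m" using mixed x eq by metis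
    obtain e where e: "e \<in> {0, 1}" "\<forall>i<m + 2. x i = (if even i then e else 1 - e)"
        "alt (m + 2) x = (if e = 1 then int n + 2 else - int n - 1)"
      using alternates[OF x False] by blast
    obtain d where d: "d \<in> {0, 1}" "\<forall>i<m + 2. y i = (if even i then d else 1 - d)"
        "alt (m + 2) y = (if d = 1 then int n + 2 else - int n - 1)"
      using alternates[OF y \<open>y \<notin> C m\<close>] by blast
    have "e = d" using e(1,3) d(1,3) eq by (auto split: if_splits)
    then show ?thesis using e(2) d(2) by (intro terms_cong[OF p]) simp
  qed
  then show ?thesis using p by blast
qed

lemma alternating_term:
  fixes \<sigma> :: "int \<Rightarrow> 'a"
  assumes "\<forall>a\<in>D. \<forall>b\<in>D. \<forall>c\<in>D. \<phi> a b c \<in> D"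
    and "\<forall>a\<in>D. \<forall>b\<in>D. \<phi> a a b = b \<and> \<phi> b a a = b"
    and \<sigma>: "\<sigma> \<in> {0, 1} \<rightarrow> D"
  shows "\<exists>f\<in>terms \<phi> (2 * n + 1). \<forall>x\<in>bits. \<forall>y\<in>bits.
           alt (2 * n + 1) x = alt (2 * n + 1) y \<longrightarrow> f (\<sigma> \<circ> x) = f (\<sigma> \<circ> y)"
proof (induction n)
  case 0
  show ?case
    by (rule bexI[of _ "\<lambda>x. x 0"]) (auto intro: terms.proj)
next
  case (Suc n)
  then obtain f where f: "f \<in> terms \<phi> (2 * n + 1)"
    and f_alt: "\<And>x y. x \<in> bits \<Longrightarrow> y \<in> bits \<Longrightarrow> alt (2 * n + 1) x = alt (2 * n + 1) y \<Longrightarrow>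
      f (\<sigma> \<circ> x) = f (\<sigma> \<circ> y)"
    by blast
  have m: "odd (2 * n + 1)" by simp
  have "2 * Suc n + 1 = 2 * n + 1 + 2" by simp
  then show ?case
    using alternating_term_step[where \<sigma> = \<sigma>, OF assms m f f_alt] by metis
qed

section \<open>Balancedness of the embedded relation\<close>

theorem theorem7p14:
  fixes k :: nat and P :: "(nat \<Rightarrow> int) set"
    and D :: "'a set" and A :: "(nat \<Rightarrow> 'a) set"
    and \<phi> :: "'a \<Rightarrow> 'a \<Rightarrow> 'a \<Rightarrow> 'a"
  assumes "P \<subseteq> tuples k {0, 1}"
    and "A \<subseteq> tuples k D"
    and "embeds_into k P D A"
    and "maltsev_polymorphism k D A \<phi>"
  shows "balanced k P"
proof -
  obtain \<sigma> where \<sigma>: "\<sigma> \<in> {0, 1} \<rightarrow> D" and inj: "inj_on \<sigma> {0, 1}"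
    and P: "(\<lambda>t. \<lambda>i\<in>{1..k}. \<sigma> (t i)) ` P = A \<inter> tuples k (\<sigma> ` {0, 1})"
    using assms(3) unfolding embeds_into_def by blast
  have closed: "\<forall>a\<in>D. \<forall>b\<in>D. \<forall>c\<in>D. \<phi> a b c \<in> D"
    and maltsev: "\<forall>a\<in>D. \<forall>b\<in>D. \<phi> a a b = b \<and> \<phi> b a a = b"
    using assms(4) unfolding maltsev_polymorphism_def by auto
  have "alternating_sum k m t \<in> P"
    if m: "odd m" and t: "\<forall>j\<in>{1..m}. t j \<in> P"
      and bool: "\<forall>i\<in>{1..k}. alternating_sum k m t i \<in> {0, 1}" for m t
  proof -
    obtain n where n: "m = 2 * n + 1" using m by (elim oddE)
    obtain f where f: "f \<in> terms \<phi> m"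
      and f_alt: "\<And>x y. x \<in> bits \<Longrightarrow> y \<in> bits \<Longrightarrow> alt m x = alt m y \<Longrightarrow> f (\<sigma> \<circ> x) = f (\<sigma> \<circ> y)"
      using alternating_term[OF closed maltsev \<sigma>, of n] unfolding n by blast
    define s where "s = alternating_sum k m t"
    \<comment> \<open>the words read off \<open>x\<close> must be Boolean at all indices, also beyond \<open>m\<close>\<close>
    define x where "x j = (if j < m then t (Suc j) else t 1)" for j
    \<comment> \<open>An odd \<open>m\<close> is at least 1, so the default \<open>t 1\<close> lies
      in \<open>P\<close>.\<close>
    have xP: "x j \<in> P" for j using t m by (auto simp: x_def elim: oddE)
    have xA: "(\<lambda>i\<in>{1..k}. \<sigma> (x j i)) \<in> A" for j using P xP by blast
    have s_alt: "alt m (\<lambda>j. x j i) = s i" if "i \<in> {1..k}" for i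
    proof -
      \<comment> \<open>Shifting the index to start at 1 raises the exponent by two in all, which
        keeps the sign.\<close>
      have "alt m (\<lambda>j. x j i) = (\<Sum>j<m. (- 1) ^ (Suc j + 1) * t (Suc j) i)"
        unfolding alt_def by (intro sum.cong) (auto simp: x_def)
      also have "\<dots> = (\<Sum>j=1..m. (- 1) ^ (j + 1) * t j i)"
        by (rule sum.reindex_bij_witness[of _ "\<lambda>j. j - 1" Suc]) auto
      finally show ?thesis using that by (simp add: s_def alternating_sum_def)
    qed
    \<comment> \<open>The column at \<open>i\<close> is compared with the constant word
      \<open>s i\<close>, which has the same alternating sum; idempotence evaluates \<open>f\<close>
      there.\<close>
    have f_s: "f (\<lambda>j. \<sigma> (x j i)) = \<sigma> (s i)" if i: "i \<in> {1..k}" for i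
    proof -
      have s: "s i \<in> {0, 1}" using bool i by (simp add: s_def)
      have "x j i \<in> {0, 1}" for j
        using xP[of j] assms(1) i unfolding tuples_def by blast
      then have "f (\<sigma> \<circ> (\<lambda>j. x j i)) = f (\<sigma> \<circ> (\<lambda>_. s i))"
        using s s_alt[OF i] alt_const[of n "s i"] unfolding n by (intro f_alt) (auto simp: n)
      moreover have "\<sigma> (s i) \<in> D" using s \<sigma> by blast
      then have "\<phi> (\<sigma> (s i)) (\<sigma> (s i)) (\<sigma> (s i)) = \<sigma> (s i)" using maltsev by blast
      then have "f (\<lambda>_. \<sigma> (s i)) = \<sigma> (s i)" by (rule terms_idem[OF f])
      ultimately show ?thesis by (simp add: o_def)
    qed
    have "(\<lambda>i\<in>{1..k}. f (\<lambda>j. (\<lambda>i\<in>{1..k}. \<sigma> (x j i)) i)) \<in> A"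
      by (rule terms_preserve[OF f assms(2,4) xA])
    also have "(\<lambda>i\<in>{1..k}. f (\<lambda>j. (\<lambda>i\<in>{1..k}. \<sigma> (x j i)) i)) = (\<lambda>i\<in>{1..k}. \<sigma> (s i))"
      using f_s by (intro restrict_ext) simp
    finally have "(\<lambda>i\<in>{1..k}. \<sigma> (s i)) \<in> A" .
    moreover have "(\<lambda>i\<in>{1..k}. \<sigma> (s i)) \<in> tuples k (\<sigma> ` {0, 1})"
      using bool unfolding tuples_def s_def by (intro restrict_PiE_iff[THEN iffD2]) blast
    ultimately obtain u where u: "u \<in> P" "(\<lambda>i\<in>{1..k}. \<sigma> (s i)) = (\<lambda>i\<in>{1..k}. \<sigma> (u i))"
      using P by blast
    have u_tup: "u \<in> {1..k} \<rightarrow>\<^sub>E {0, 1}" using u(1) assms(1) unfolding tuples_def by blast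
    \<comment> \<open>On \<open>{1..k}\<close> injectivity of \<open>\<sigma>\<close> applies;
      elsewhere both functions are \<open>undefined\<close>.\<close>
    have "s i = u i" for i
    proof (cases "i \<in> {1..k}")
      case True
      then have "\<sigma> (s i) = \<sigma> (u i)" using u(2) by (metis restrict_apply')
      moreover have "s i \<in> {0, 1}" "u i \<in> {0, 1}"
        using True bool u_tup unfolding s_def by blast+
      ultimately show ?thesis using inj by (meson inj_onD)
    next
      case False
      then have "s i = undefined"
        unfolding s_def alternating_sum_def by (rule restrict_apply[THEN trans, OF if_not_P])
      with False show ?thesis using PiE_arb[OF u_tup] by metis
    qed
    then have "s = u" by blast
    with u(1) show ?thesis by (simp add: s_def)
  qed
  then show ?thesis unfolding balanced_def by blast
qed

end
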